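(* Let $G$ be a connected non-complete graph of order $n\ge 2$ and let $H$ be a graph of order $n'\ge 2$ and maximum degree $\Delta(H)\le n'-2$. (i) If $D(H)=2$, then $\dim_s(G\circ H)=n\cdot \dim_s(H) + n'\cdot \alpha(G_{SRS})-\alpha(G_{SRS})\dim_s(H)$. (ii) If $D(H)> 2$, then $\dim_s(G\circ H)=n\cdot \dim_s(K_1+H) + n'\cdot \alpha(G_{SRS})-\alpha(G_{SRS})\dim_s(K_1+H)$.
   Context: All graphs are simple and undirected. The order of a graph is its number of vertices. $D(H)=\max_{u,v\in V(H)} d_H(u,v)$ is the diameter; if $H$ is not connected, the distance between vertices in different components is infinite and $D(H)=\infty$ (so non-connected $H$ falls under the case $D(H)>2$). The lexicographic product $G\circ H$ has vertex set $V(G)\times V(H)$, and $(a,b),(c,d)$ are adjacent if and only if either $ac\in E(G)$, or ($a=c$ and $bd\in E(H)$). $K_1+H$ denotes the join of $K_1$ and $H$: the graph obtained from $H$ by adding one new vertex adjacent to every vertex of $H$. $\alpha(F)$ denotes the vertex cover number of $F$, i.e. the smallest cardinality of a set of vertices meeting every edge of $F$. For a connected graph $F$, a vertex $w$ strongly resolves two vertices $u,v$ if $d_F(w,u)=d_F(w,v)+d_F(v,u)$ or $d_F(w,v)=d_F(w,u)+d_F(u,v)$. A set $S\subseteq V(F)$ is a strong metric generator for $F$ if every two distinct vertices of $F$ are strongly resolved by some vertex of $S$. The strong metric dimension $\dim_s(F)$ is the smallest cardinality of a strong metric generator for $F$. A vertex $u$ of $G$ is maximally distant from $v$ if $d_G(v,w)\le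 d_G(u,v)$ for every $w\in N_G(u)$; $u$ and $v$ are mutually maximally distant if each is maximally distant from the other. $N_G[v]=N_G(v)\cup\{v\}$ is the closed neighborhood. The TF-boundary $\partial_{TF}(G)$ is the set of vertices $x$ of $G$ for which there exists a vertex $y$ such that $x$ and $y$ are mutually maximally distant in $G$ and $N_G[x]\ne N_G[y]$. The strong resolving TF-graph $G_{SRS}$ of a non-complete graph $G$ has vertex set $\partial_{TF}(G)$, and two vertices $u,v$ are adjacent in $G_{SRS}$ if and only if $u$ and $v$ are mutually maximally distant in $G$ and $N_G[u]\ne N_G[v]$. *)

theory Defs
  imports "Graph_Theory.Graph_Theory"
begin

text \<open>
  Finite simple undirected graphs are the locale \<^locale>\<open>pair_graph\<close>: the arc set is a symmetric
  irreflexive relation on the finite vertex set, an edge being a pair of opposite arcs.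
\<close>

text \<open>Unit-weight shortest-path length; the value is \<open>\<infinity>\<close> if no walk exists.\<close>

definition gdist :: "'a pair_pre_digraph \<Rightarrow> 'a \<Rightarrow> 'a \<Rightarrow> ereal" where
  "gdist G u v = wf_digraph.\<mu> (with_proj G) (\<lambda>_. 1) u v"

definition diameter :: "'a pair_pre_digraph \<Rightarrow> ereal" where
  "diameter G = (SUP (u, v) \<in> pverts G \<times> pverts G. gdist G u v)"

definition max_degree :: "'a pair_pre_digraph \<Rightarrow> nat" where
  "max_degree G = Max (out_degree (with_proj G) ` pverts G)"

definition is_complete :: "'a pair_pre_digraph \<Rightarrow> bool" where
  "is_complete G \<longleftrightarrow> complete_digraph (card (pverts G)) (with_proj G)"

definition nbhd :: "'a pair_pre_digraph \<Rightarrow> 'a \<Rightarrow> 'a set" where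
  "nbhd G v = {w. (v, w) \<in> parcs G}"

definition closed_nbhd :: "'a pair_pre_digraph \<Rightarrow> 'a \<Rightarrow> 'a set" where
  "closed_nbhd G v = nbhd G v \<union> {v}"

definition lex_product ::
  "'a pair_pre_digraph \<Rightarrow> 'b pair_pre_digraph \<Rightarrow> ('a \<times> 'b) pair_pre_digraph" where
  "lex_product G H =
    \<lparr> pverts = pverts G \<times> pverts H,
      parcs = {((a, b), (c, d)) | a b c d.
        (a, b) \<in> pverts G \<times> pverts H \<and> (c, d) \<in> pverts G \<times> pverts H \<and>
        ((a, c) \<in> parcs G \<or> a = c \<and> (b, d) \<in> parcs H)} \<rparr>"

text \<open>The join \<open>K\<^sub>1 + H\<close>; \<open>None\<close> is the vertex of \<open>K\<^sub>1\<close>.\<close>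

definition K1_join :: "'a pair_pre_digraph \<Rightarrow> 'a option pair_pre_digraph" where
  "K1_join H =
    \<lparr> pverts = {None} \<union> Some ` pverts H,
      parcs = {(Some u, Some v) | u v. (u, v) \<in> parcs H}
        \<union> {None} \<times> Some ` pverts H \<union> Some ` pverts H \<times> {None} \<rparr>"

definition vertex_cover :: "'a pair_pre_digraph \<Rightarrow> 'a set \<Rightarrow> bool" where
  "vertex_cover G S \<longleftrightarrow> S \<subseteq> pverts G \<and> (\<forall>(u, v) \<in> parcs G. u \<in> S \<or> v \<in> S)"

definition vertex_cover_number :: "'a pair_pre_digraph \<Rightarrow> nat" where
  "vertex_cover_number G = (LEAST k. \<exists>S. vertex_cover G S \<and> card S = k)"

text \<open>
  The notions of strong resolvability are meant for connected graphs only: with infinite distances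
  the equations below may hold as \<open>\<infinity> = \<infinity>\<close>.
\<close>

definition strongly_resolves :: "'a pair_pre_digraph \<Rightarrow> 'a \<Rightarrow> 'a \<Rightarrow> 'a \<Rightarrow> bool" where
  "strongly_resolves G w u v \<longleftrightarrow>
    gdist G w u = gdist G w v + gdist G v u \<or> gdist G w v = gdist G w u + gdist G u v"

definition strong_metric_generator :: "'a pair_pre_digraph \<Rightarrow> 'a set \<Rightarrow> bool" where
  "strong_metric_generator G S \<longleftrightarrow> S \<subseteq> pverts G \<and>
    (\<forall>u \<in> pverts G. \<forall>v \<in> pverts G. u \<noteq> v \<longrightarrow> (\<exists>w \<in> S. strongly_resolves G w u v))"

definition strong_metric_dim :: "'a pair_pre_digraph \<Rightarrow> nat" where
  "strong_metric_dim G = (LEAST k. \<exists>S. strong_metric_generator G S \<and> card S = k)"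

text \<open>\<open>maximally_distant G u v\<close>: the vertex \<open>u\<close> is maximally distant from \<open>v\<close>.\<close>

definition maximally_distant :: "'a pair_pre_digraph \<Rightarrow> 'a \<Rightarrow> 'a \<Rightarrow> bool" where
  "maximally_distant G u v \<longleftrightarrow> (\<forall>w \<in> nbhd G u. gdist G v w \<le> gdist G u v)"

definition mutually_maximally_distant :: "'a pair_pre_digraph \<Rightarrow> 'a \<Rightarrow> 'a \<Rightarrow> bool" where
  "mutually_maximally_distant G u v \<longleftrightarrow> maximally_distant G u v \<and> maximally_distant G v u"

definition TF_boundary :: "'a pair_pre_digraph \<Rightarrow> 'a set" where
  "TF_boundary G = {x \<in> pverts G. \<exists>y \<in> pverts G.
    mutually_maximally_distant G x y \<and> closed_nbhd G x \<noteq> closed_nbhd G y}"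

definition strong_resolving_TF_graph :: "'a pair_pre_digraph \<Rightarrow> 'a pair_pre_digraph" where
  "strong_resolving_TF_graph G =
    \<lparr> pverts = TF_boundary G,
      parcs = {(u, v). u \<in> TF_boundary G \<and> v \<in> TF_boundary G \<and>
        mutually_maximally_distant G u v \<and> closed_nbhd G u \<noteq> closed_nbhd G v} \<rparr>"

lemma pair_graph_lex_product:
  assumes "pair_graph G" "pair_graph H"
  shows "pair_graph (lex_product G H)"
proof -
  interpret G: pair_graph G by fact
  interpret H: pair_graph H by fact
  have "parcs (lex_product G H) \<subseteq> (pverts G \<times> pverts H) \<times> (pverts G \<times> pverts H)"
    by (auto simp: lex_product_def)
  then have "finite (parcs (lex_product G H))"
    by (rule finite_subset) (simp add: G.pair_finite_verts H.pair_finite_verts)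
  moreover have "sym (parcs (lex_product G H))"
    using G.pair_sym_arcs H.pair_sym_arcs
    by (auto simp: lex_product_def symmetric_def sym_def)
  moreover have "fst e \<noteq> snd e" if "e \<in> parcs (lex_product G H)" for e
    using that G.pair_no_loops H.pair_no_loops by (fastforce simp: lex_product_def)
  ultimately show ?thesis
    by unfold_locales (auto simp: lex_product_def symmetric_def)
qed

lemma pair_graph_K1_join:
  assumes "pair_graph H"
  shows "pair_graph (K1_join H)"
proof -
  interpret H: pair_graph H by fact
  have "parcs (K1_join H) \<subseteq> pverts (K1_join H) \<times> pverts (K1_join H)"
    by (auto simp: K1_join_def dest: H.in_arcsD1 H.in_arcsD2)
  moreover have "finite (pverts (K1_join H))"
    by (simp add: K1_join_def H.pair_finite_verts)
  moreover have "sym (parcs (K1_join H))"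
    using H.pair_sym_arcs by (auto simp: K1_join_def symmetric_def sym_def)
  moreover have "fst e \<noteq> snd e" if "e \<in> parcs (K1_join H)" for e
    using that H.pair_no_loops by (fastforce simp: K1_join_def)
  ultimately show ?thesis
    by unfold_locales (auto simp: symmetric_def intro: finite_subset)
qed

lemma pair_graph_strong_resolving_TF_graph:
  assumes "pair_graph G"
  shows "pair_graph (strong_resolving_TF_graph G)"
proof -
  interpret G: pair_graph G by fact
  let ?S = "strong_resolving_TF_graph G"
  have "parcs ?S \<subseteq> pverts ?S \<times> pverts ?S"
    by (auto simp: strong_resolving_TF_graph_def)
  moreover have "finite (pverts ?S)"
    by (simp add: strong_resolving_TF_graph_def TF_boundary_def G.pair_finite_verts)
  moreover have "sym (parcs ?S)"
    by (auto simp: strong_resolving_TF_graph_def sym_def mutually_maximally_distant_def)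
  moreover have "fst e \<noteq> snd e" if "e \<in> parcs ?S" for e
    using that by (auto simp: strong_resolving_TF_graph_def)
  ultimately show ?thesis
    by unfold_locales (auto simp: symmetric_def intro: finite_subset)
qed

end

theory Submission
  imports Defs
begin

text \<open>
  The strong metric dimension of a connected graph is a vertex cover number (Oellermann and
  Peters-Fransen): a vertex that strongly resolves two mutually maximally distant vertices must
  be one of them, while any two distinct vertices lie on a shortest path whose ends are mutually
  maximally distant, and either end resolves them. So a strong metric generator is the same as a
  vertex cover of the graph of mutually maximally distant pairs, the strong resolving graph
  (lemma \<open>strong_metric_generator_iff_vertex_cover\<close>).

  It remains to compute this graph for \<open>G \<circ> H\<close>. Two vertices in different copies of \<open>H\<close> are as
  far apart as their projections to \<open>G\<close>. If the projections are adjacent, the pair is never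
  mutually maximally distant: because \<open>\<Delta>(H) \<le> n' - 2\<close>, one end has a neighbour in the copy of
  the other that is at distance \<open>2\<close> from that other end. Otherwise the pair is mutually maximally distant exactly
  when the projections are. The edges of \<open>G\<^sub>S\<^sub>R\<^sub>S\<close> are the non-adjacent mutually maximally distant
  pairs of \<open>G\<close>, since adjacent ones are true twins; so vertices in different copies are mutually
  maximally distant exactly when their projections are adjacent in \<open>G\<^sub>S\<^sub>R\<^sub>S\<close>. Inside one copy all
  distances are at most \<open>2\<close>, through a neighbouring copy, and the mutually maximally distant pairs
  are the non-adjacent pairs and the true twins of \<open>H\<close>. Hence the strong resolving graph of
  \<open>G \<circ> H\<close> is the lexicographic product of \<open>G\<^sub>S\<^sub>R\<^sub>S\<close>, padded with isolated vertices to all of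
  \<open>V(G)\<close>, and the graph \<open>T(H)\<close> of non-adjacent pairs and true twins of \<open>H\<close>
  (lemma \<open>strong_resolving_graph_lex_product\<close>).

  A vertex cover of a lexicographic product \<open>A \<circ> B\<close> restricts to a cover of every copy of \<open>B\<close>, and
  the copies that it contains completely form a cover of \<open>A\<close>. This gives
  \<open>\<alpha>(A \<circ> B) + \<alpha>(A) \<alpha>(B) = |A| \<alpha>(B) + |B| \<alpha>(A)\<close>
  (lemma \<open>vertex_cover_number_lex_product\<close>), where \<open>|\<cdot>|\<close> is the order.

  Finally \<open>\<alpha>(T(H))\<close> is itself a strong metric dimension: \<open>T(F)\<close> is the strong resolving graph of
  every graph \<open>F\<close> in which distinct non-adjacent vertices have a common neighbour. If \<open>D(H) = 2\<close>
  this applies to \<open>H\<close>; in any case it applies to \<open>K\<^sub>1 + H\<close>, and the apex is isolated in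
  \<open>T(K\<^sub>1 + H)\<close> since no vertex of \<open>H\<close> dominates \<open>H\<close>.
\<close>

section \<open>Vertex cover numbers\<close>

text \<open>
  The generality at which covers can be counted: it contains all finite simple graphs, and it
  guarantees that the whole vertex set is a cover of finite size.
\<close>

definition finite_arc_graph :: "'a pair_pre_digraph \<Rightarrow> bool" where
  "finite_arc_graph A \<longleftrightarrow> finite (pverts A) \<and> parcs A \<subseteq> pverts A \<times> pverts A"

lemma finite_arc_graph_if_pair_graph: "pair_graph A \<Longrightarrow> finite_arc_graph A"
proof -
  assume "pair_graph A"
  then interpret pair_graph A .
  show "finite_arc_graph A"
    using pair_finite_verts by (auto simp: finite_arc_graph_def dest: in_arcsD1 in_arcsD2)
qed

lemma vertex_cover_number_attained:
  assumes "finite_arc_graph A"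
  obtains S where "vertex_cover A S" "card S = vertex_cover_number A"
proof -
  have "vertex_cover A (pverts A)"
    using assms by (auto simp: vertex_cover_def finite_arc_graph_def)
  then have "\<exists>k S. vertex_cover A S \<and> card S = k" by blast
  from LeastI_ex[OF this] show thesis
    using that unfolding vertex_cover_number_def by blast
qed

lemma vertex_cover_number_le: "vertex_cover A S \<Longrightarrow> vertex_cover_number A \<le> card S"
  unfolding vertex_cover_number_def by (rule Least_le) blast

lemma vertex_cover_number_le_order:
  "finite_arc_graph A \<Longrightarrow> vertex_cover_number A \<le> card (pverts A)"
  by (rule vertex_cover_number_le) (auto simp: vertex_cover_def finite_arc_graph_def)

text \<open>
  Vertices of \<open>A\<close> outside the image of \<open>f\<close> are isolated, and isolated vertices can be dropped from
  a cover.
\<close>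

lemma vertex_cover_number_embedding:
  assumes A: "finite_arc_graph A" and B: "finite_arc_graph B"
    and inj: "inj_on f (pverts B)" and sub: "f ` pverts B \<subseteq> pverts A"
    and arcs: "parcs A = map_prod f f ` parcs B"
  shows "vertex_cover_number A = vertex_cover_number B"
proof (rule antisym)
  obtain T where T: "vertex_cover B T" "card T = vertex_cover_number B"
    using vertex_cover_number_attained[OF B] .
  then have TB: "T \<subseteq> pverts B" by (simp add: vertex_cover_def)
  have "vertex_cover A (f ` T)"
    using T sub arcs by (fastforce simp: vertex_cover_def)
  from vertex_cover_number_le[OF this]
  show "vertex_cover_number A \<le> vertex_cover_number B"
    using T(2) card_image[OF inj_on_subset[OF inj TB]] by simp
next
  obtain S where S: "vertex_cover A S" "card S = vertex_cover_number A"
    using vertex_cover_number_attained[OF A] .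
  define T where "T = {b \<in> pverts B. f b \<in> S}"
  have "finite S"
    using S A by (auto simp: vertex_cover_def finite_arc_graph_def intro: finite_subset)
  moreover have "f ` T \<subseteq> S" by (auto simp: T_def)
  ultimately have "card (f ` T) \<le> card S" by (rule card_mono)
  moreover have "card (f ` T) = card T"
    by (rule card_image) (rule inj_on_subset[OF inj], auto simp: T_def)
  moreover have "vertex_cover B T"
    unfolding vertex_cover_def
  proof (intro conjI ballI, goal_cases)
    case 1 then show ?case by (auto simp: T_def)
  next
    case (2 e)
    obtain u v where e: "e = (u, v)" by (cases e)
    have uv: "u \<in> pverts B" "v \<in> pverts B" using 2 e B by (auto simp: finite_arc_graph_def)
    have "(f u, f v) \<in> parcs A" using 2 e arcs by force
    then show ?case using S(1) uv e by (auto simp: vertex_cover_def T_def)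
  qed
  ultimately show "vertex_cover_number B \<le> vertex_cover_number A"
    using vertex_cover_number_le[of B T] S(2) by linarith
qed

text \<open>
  This is the vertex cover form of the theorem of Geller and Stahl that the independence number is
  multiplicative on lexicographic products.
\<close>

lemma vertex_cover_number_lex_product:
  assumes A: "finite_arc_graph A" and B: "finite_arc_graph B"
  shows "vertex_cover_number (lex_product A B) + vertex_cover_number A * vertex_cover_number B =
    card (pverts A) * vertex_cover_number B + card (pverts B) * vertex_cover_number A"
proof -
  define \<alpha> \<beta> where "\<alpha> = vertex_cover_number A" and "\<beta> = vertex_cover_number B"
  let ?P = "lex_product A B"
  have fin: "finite (pverts A)" "finite (pverts B)"
    using A B by (auto simp: finite_arc_graph_def)
  have P: "finite_arc_graph ?P"
    using fin by (auto simp: finite_arc_graph_def lex_product_def)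
  have \<beta>_le: "\<beta> \<le> card (pverts B)"
    using vertex_cover_number_le_order[OF B] by (simp add: \<beta>_def)
  \<comment> \<open>The size of a cover that fills the copies over \<open>F\<close> and has \<open>\<beta>\<close> vertices in each other copy.\<close>
  have count: "(\<Sum>a\<in>pverts A. if a \<in> F then card (pverts B) else \<beta>) =
      card (pverts A) * \<beta> + card F * (card (pverts B) - \<beta>)" if "F \<subseteq> pverts A" for F
  proof -
    have "(\<Sum>a\<in>pverts A. if a \<in> F then card (pverts B) else \<beta>) =
        (\<Sum>a\<in>pverts A. \<beta> + (if a \<in> F then card (pverts B) - \<beta> else 0))"
      using \<beta>_le by (intro sum.cong) auto
    also have "\<dots> = card (pverts A) * \<beta> + (\<Sum>a\<in>pverts A \<inter> F. card (pverts B) - \<beta>)"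
      using fin by (simp add: sum.distrib flip: sum.inter_restrict)
    also have "pverts A \<inter> F = F" using that by blast
    finally show ?thesis by simp
  qed
  have "vertex_cover_number ?P \<le> card (pverts A) * \<beta> + \<alpha> * (card (pverts B) - \<beta>)"
  proof -
    obtain S where S: "vertex_cover A S" "card S = \<alpha>"
      using vertex_cover_number_attained[OF A] unfolding \<alpha>_def .
    obtain T where T: "vertex_cover B T" "card T = \<beta>"
      using vertex_cover_number_attained[OF B] unfolding \<beta>_def .
    have SA: "S \<subseteq> pverts A" and TB: "T \<subseteq> pverts B" using S T by (auto simp: vertex_cover_def)
    define U where "U = (SIGMA a:pverts A. if a \<in> S then pverts B else T)"
    have "vertex_cover ?P U"
      using S(1) T(1) by (auto simp: vertex_cover_def U_def lex_product_def split: if_splits)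
    moreover have "card U = (\<Sum>a\<in>pverts A. card (if a \<in> S then pverts B else T))"
      unfolding U_def using fin finite_subset[OF TB] by (intro card_SigmaI) auto
    moreover have "\<dots> = (\<Sum>a\<in>pverts A. if a \<in> S then card (pverts B) else \<beta>)"
      using T(2) by (intro sum.cong) auto
    ultimately show ?thesis
      using vertex_cover_number_le[of ?P U] count[OF SA] S(2) by simp
  qed
  moreover have "card (pverts A) * \<beta> + \<alpha> * (card (pverts B) - \<beta>) \<le> vertex_cover_number ?P"
  proof -
    obtain U where U: "vertex_cover ?P U" "card U = vertex_cover_number ?P"
      using vertex_cover_number_attained[OF P] .
    define fibre where "fibre a = {b. (a, b) \<in> U}" for a
    define F where "F = {a \<in> pverts A. fibre a = pverts B}"
    have FA: "F \<subseteq> pverts A" by (auto simp: F_def)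
    have UV: "U \<subseteq> pverts A \<times> pverts B"
      using U(1) by (auto simp: vertex_cover_def lex_product_def)
    then have fibre_sub: "fibre a \<subseteq> pverts B" for a by (auto simp: fibre_def)
    have cov: "p \<in> U \<or> q \<in> U" if "(p, q) \<in> parcs ?P" for p q
      using U(1) that by (auto simp: vertex_cover_def)
    have fibre_cover: "vertex_cover B (fibre a)" if "a \<in> pverts A" for a
      unfolding vertex_cover_def
    proof (intro conjI ballI, goal_cases)
      case 1 show ?case by (rule fibre_sub)
    next
      case (2 e)
      obtain b b' where e: "e = (b, b')" by (cases e)
      have "((a, b), (a, b')) \<in> parcs ?P"
        using 2 e that B by (auto simp: lex_product_def finite_arc_graph_def)
      from cov[OF this] show ?case using e by (auto simp: fibre_def)
    qed
    \<comment> \<open>Two non-full copies over an arc of \<open>A\<close> would leave an arc between two missing vertices.\<close>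
    have "vertex_cover A F"
      unfolding vertex_cover_def
    proof (intro conjI ballI, goal_cases)
      case 1 show ?case by (rule FA)
    next
      case (2 e)
      obtain a c where e: "e = (a, c)" by (cases e)
      have ac: "a \<in> pverts A" "c \<in> pverts A" using 2 e A by (auto simp: finite_arc_graph_def)
      have "a \<in> F \<or> c \<in> F"
      proof (rule ccontr)
        assume "\<not> (a \<in> F \<or> c \<in> F)"
        then obtain b b' where "b \<in> pverts B" "b \<notin> fibre a" "b' \<in> pverts B" "b' \<notin> fibre c"
          using ac fibre_sub[of a] fibre_sub[of c] by (auto simp: F_def)
        moreover from this have "((a, b), (c, b')) \<in> parcs ?P"
          using 2 e ac by (auto simp: lex_product_def)
        ultimately show False using cov by (auto simp: fibre_def)
      qed
      then show ?case using e by simp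
    qed
    then have "\<alpha> \<le> card F" unfolding \<alpha>_def by (rule vertex_cover_number_le)
    then have "card (pverts A) * \<beta> + \<alpha> * (card (pverts B) - \<beta>) \<le>
        card (pverts A) * \<beta> + card F * (card (pverts B) - \<beta>)"
      by simp
    also have "\<dots> = (\<Sum>a\<in>pverts A. if a \<in> F then card (pverts B) else \<beta>)"
      using count[OF FA] by simp
    also have "\<dots> \<le> (\<Sum>a\<in>pverts A. card (fibre a))"
      using vertex_cover_number_le[OF fibre_cover] by (intro sum_mono) (auto simp: F_def \<beta>_def)
    also have "\<dots> = card (SIGMA a:pverts A. fibre a)"
      using fin finite_subset[OF fibre_sub] by (intro card_SigmaI[symmetric]) auto
    also have "(SIGMA a:pverts A. fibre a) = U" using UV by (auto simp: fibre_def)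
    finally show ?thesis using U(2) by simp
  qed
  ultimately have "vertex_cover_number ?P = card (pverts A) * \<beta> + \<alpha> * (card (pverts B) - \<beta>)"
    by (rule antisym)
  moreover have "\<alpha> * (card (pverts B) - \<beta>) + \<alpha> * \<beta> = card (pverts B) * \<alpha>"
    using \<beta>_le by (simp add: diff_mult_distrib2 mult.commute)
  ultimately show ?thesis by (simp add: \<alpha>_def \<beta>_def)
qed

section \<open>Distances with values in the natural numbers\<close>

text \<open>
  The three conditions determine the distance of a connected graph: stepping along an arc changes
  the value by at most one, and from every other vertex some step decreases it. Proposed distance
  functions for the product, for \<open>K\<^sub>1 + H\<close> and for \<open>H\<close> are justified by checking them, without
  any further work on walks.
\<close>

locale graph_distance = pair_graph G for G :: "'a pair_pre_digraph" +
  fixes d :: "'a \<Rightarrow> 'a \<Rightarrow> nat"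
  assumes dist_eq_0_iff:
      "\<lbrakk>u \<in> pverts G; v \<in> pverts G\<rbrakk> \<Longrightarrow> d u v = 0 \<longleftrightarrow> u = v"
    and dist_step: "\<lbrakk>(u, x) \<in> parcs G; v \<in> pverts G\<rbrakk> \<Longrightarrow> d u v \<le> Suc (d x v)"
    and dist_descent: "\<lbrakk>u \<in> pverts G; v \<in> pverts G; u \<noteq> v\<rbrakk> \<Longrightarrow>
      \<exists>x. (u, x) \<in> parcs G \<and> d u v = Suc (d x v)"

context pair_graph
begin

lemma arc_sym: "(u, v) \<in> parcs G \<Longrightarrow> (v, u) \<in> parcs G"
  using pair_sym_arcs by (auto simp: symmetric_def sym_def)

lemma arc_irrefl: "(u, u) \<notin> parcs G"
  using pair_no_loops by fastforce

lemma walk_cost_eq_length: "awalk_cost (\<lambda>_. 1) p = real (length p)"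
  by (induct p) auto

end

context graph_distance
begin

lemma dist_self: "u \<in> pverts G \<Longrightarrow> d u u = 0"
  by (simp add: dist_eq_0_iff)

lemma dist_arc_le: "(u, v) \<in> parcs G \<Longrightarrow> d u v \<le> 1"
  using dist_step[of u v v] dist_self[of v] in_arcsD2[of u v] by auto

lemma dist_triangle:
  assumes "u \<in> pverts G" "v \<in> pverts G" "w \<in> pverts G"
  shows "d u v \<le> d u w + d w v"
  using assms
proof (induct "d u w" arbitrary: u)
  case 0
  then show ?case by (simp add: dist_eq_0_iff)
next
  case (Suc k)
  then have "u \<noteq> w" using dist_self by force
  then obtain x where x: "(u, x) \<in> parcs G" "d u w = Suc (d x w)"
    using dist_descent Suc.prems by blast
  then have "d x v \<le> d x w + d w v"
    using Suc.hyps Suc.prems in_arcsD2 by auto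
  then show ?case using dist_step[OF x(1) Suc.prems(2)] x(2) by linarith
qed

lemma dist_commute:
  assumes "u \<in> pverts G" "v \<in> pverts G"
  shows "d u v = d v u"
proof -
  have "d v u \<le> d u v" if "u \<in> pverts G" "v \<in> pverts G" for u v
    using that
  proof (induct "d u v" arbitrary: u)
    case 0
    then show ?case by (simp add: dist_eq_0_iff)
  next
    case (Suc k)
    then have "u \<noteq> v" using dist_self by force
    then obtain x where x: "(u, x) \<in> parcs G" "d u v = Suc (d x v)"
      using dist_descent Suc.prems by blast
    have xV: "x \<in> pverts G" using x in_arcsD2 by blast
    have "d v x \<le> d x v" using Suc.hyps Suc.prems x xV by auto
    moreover have "d v u \<le> d v x + d x u" using dist_triangle Suc.prems xV by blast
    moreover have "d x u \<le> 1" using dist_arc_le arc_sym x by blast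
    ultimately show ?case using x(2) by linarith
  qed
  then show ?thesis using assms by (simp add: antisym)
qed

lemma dist_eq_1_iff:
  assumes "u \<in> pverts G" "v \<in> pverts G"
  shows "d u v = 1 \<longleftrightarrow> (u, v) \<in> parcs G"
proof
  assume 1: "d u v = 1"
  then have "u \<noteq> v" using dist_self assms by force
  then obtain x where x: "(u, x) \<in> parcs G" "d u v = Suc (d x v)"
    using dist_descent assms by blast
  then have "x = v" using 1 dist_eq_0_iff[of x v] assms in_arcsD2 by auto
  then show "(u, v) \<in> parcs G" using x by simp
next
  assume uv: "(u, v) \<in> parcs G"
  then have "u \<noteq> v" using arc_irrefl by blast
  then have "d u v \<noteq> 0" using dist_eq_0_iff assms by simp
  then show "d u v = 1" using dist_arc_le[OF uv] by simp
qed

lemma gdist_eq: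
  assumes "u \<in> pverts G" "v \<in> pverts G"
  shows "gdist G u v = ereal (real (d u v))"
proof -
  have "d u v \<le> length p" if "awalk u p v" "u \<in> pverts G" for u p
    using that
  proof (induct p arbitrary: u)
    case Nil
    then show ?case by (auto simp: awalk_Nil_iff dist_self)
  next
    case (Cons e p)
    then have e: "e \<in> parcs G" "u = fst e" "awalk (snd e) p v"
      by (auto simp: awalk_Cons_iff)
    then have ue: "(u, snd e) \<in> parcs G" by simp
    then have "d (snd e) v \<le> length p" using Cons.hyps e(3) in_arcsD2 by blast
    then show ?case using dist_step[OF ue assms(2)] by simp
  qed
  then have "ereal (real (d u v)) \<le> \<mu> (\<lambda>_. 1) u v"
    unfolding \<mu>_def using assms by (intro INF_greatest) (auto simp: walk_cost_eq_length)
  moreover have "\<exists>p. awalk u p v \<and> length p = d u v"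
    using assms(1)
  proof (induct "d u v" arbitrary: u)
    case 0
    then show ?case using assms(2) by (intro exI[of _ "[]"]) (simp add: dist_eq_0_iff awalk_Nil_iff)
  next
    case (Suc k)
    then have "u \<noteq> v" using dist_self by force
    then obtain x where x: "(u, x) \<in> parcs G" "d u v = Suc (d x v)"
      using dist_descent Suc.prems assms(2) by blast
    then obtain p where "awalk x p v" "length p = d x v"
      using Suc.hyps in_arcsD2 by fastforce
    then show ?case using x by (intro exI[of _ "(u, x) # p"]) (auto simp: awalk_Cons_iff)
  qed
  then have "\<mu> (\<lambda>_. 1) u v \<le> ereal (real (d u v))"
    using min_cost_le_walk_cost[of u _ v "\<lambda>_. 1"] by (metis walk_cost_eq_length)
  ultimately show ?thesis unfolding gdist_def by (rule antisym[rotated])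
qed

lemma mutually_maximally_distant_iff:
  assumes "u \<in> pverts G" "v \<in> pverts G"
  shows "mutually_maximally_distant G u v \<longleftrightarrow>
    (\<forall>x. (u, x) \<in> parcs G \<longrightarrow> d x v \<le> d u v) \<and> (\<forall>x. (v, x) \<in> parcs G \<longrightarrow> d u x \<le> d u v)"
proof -
  have "gdist G v x \<le> gdist G u v \<longleftrightarrow> d x v \<le> d u v" if "(u, x) \<in> parcs G" for x
  proof -
    have x: "x \<in> pverts G" using in_arcsD2 that by blast
    show ?thesis by (simp add: gdist_eq assms x dist_commute[OF x assms(2)])
  qed
  moreover have "gdist G u x \<le> gdist G v u \<longleftrightarrow> d u x \<le> d u v" if "(v, x) \<in> parcs G" for x
  proof -
    have x: "x \<in> pverts G" using in_arcsD2 that by blast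
    show ?thesis by (simp add: gdist_eq assms x dist_commute[OF assms])
  qed
  ultimately show ?thesis
    by (auto simp: mutually_maximally_distant_def maximally_distant_def nbhd_def)
qed

lemma strongly_resolves_iff:
  assumes "u \<in> pverts G" "v \<in> pverts G" "w \<in> pverts G"
  shows "strongly_resolves G w u v \<longleftrightarrow> d w u = d w v + d v u \<or> d w v = d w u + d u v"
  using assms by (simp add: strongly_resolves_def gdist_eq flip: of_nat_add)

end

context pair_graph
begin

lemma connected_graph_distance:
  assumes "connected (with_proj G)"
  obtains d where "graph_distance G d"
proof -
  define d where "d u v = (LEAST k. \<exists>p. awalk u p v \<and> length p = k)" for u v
  have "strongly_connected (with_proj G)"
    using assms sym_arcs by (rule symmetric_connected_imp_strongly_connected[rotated])
  then have "\<exists>p. awalk u p v" if "u \<in> pverts G" "v \<in> pverts G" for u v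
    using that reachable_awalk by (auto simp: strongly_connected_def)
  then have "\<exists>k p. awalk u p v \<and> length p = k" if "u \<in> pverts G" "v \<in> pverts G" for u v
    using that by blast
  from LeastI_ex[OF this]
  have walk: "\<exists>p. awalk u p v \<and> length p = d u v" if "u \<in> pverts G" "v \<in> pverts G" for u v
    using that unfolding d_def by blast
  have d_le: "d u v \<le> length p" if "awalk u p v" for u v p
    unfolding d_def using that by (intro Least_le) blast
  have step: "d u v \<le> Suc (d x v)" if ux: "(u, x) \<in> parcs G" and v: "v \<in> pverts G" for u x v
  proof -
    obtain p where p: "awalk x p v" "length p = d x v" using walk ux v in_arcsD2 by blast
    then have "awalk u ((u, x) # p) v" using ux by (simp add: awalk_Cons_iff)
    from d_le[OF this] p show ?thesis by simp
  qed
  have "graph_distance G d"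
  proof unfold_locales
    fix u v assume uv: "u \<in> pverts G" "v \<in> pverts G"
    show "d u v = 0 \<longleftrightarrow> u = v"
    proof
      assume "d u v = 0"
      then show "u = v" using walk[OF uv] by (auto simp: awalk_Nil_iff)
    next
      assume "u = v"
      then show "d u v = 0" using d_le[of u "[]" v] uv by (simp add: awalk_Nil_iff)
    qed
  next
    fix u v assume uv: "u \<in> pverts G" "v \<in> pverts G" "u \<noteq> v"
    obtain p where p: "awalk u p v" "length p = d u v" using walk uv by blast
    then obtain e q where "p = e # q" using uv by (cases p) (auto simp: awalk_Nil_iff)
    then have e: "(u, snd e) \<in> parcs G" "awalk (snd e) q v" "d u v = Suc (length q)"
      using p by (auto simp: awalk_Cons_iff)
    then have "d u v = Suc (d (snd e) v)"
      using d_le[OF e(2)] step[OF e(1) uv(2)] by linarith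
    then show "\<exists>x. (u, x) \<in> parcs G \<and> d u v = Suc (d x v)" using e by blast
  qed (fact step)
  then show thesis by (rule that)
qed

end

section \<open>The strong resolving graph\<close>

definition strong_resolving_graph :: "'a pair_pre_digraph \<Rightarrow> 'a pair_pre_digraph" where
  "strong_resolving_graph G =
    \<lparr> pverts = pverts G,
      parcs = {(u, v). u \<in> pverts G \<and> v \<in> pverts G \<and> u \<noteq> v \<and>
        mutually_maximally_distant G u v} \<rparr>"

context graph_distance
begin

text \<open>
  If \<open>w \<noteq> v\<close> lies beyond \<open>v\<close> as seen from \<open>u\<close>, then the first step from \<open>v\<close> towards \<open>w\<close> leads
  further away from \<open>u\<close>.
\<close>

lemma resolver_beyond_maximally_distant:
  assumes "u \<in> pverts G" "v \<in> pverts G" "w \<in> pverts G"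
    and mmd: "mutually_maximally_distant G u v" and eq: "d w u = d w v + d v u"
  shows "w = v"
proof (rule ccontr)
  assume "w \<noteq> v"
  then obtain x where x: "(v, x) \<in> parcs G" "d v w = Suc (d x w)"
    using dist_descent assms by metis
  have xV: "x \<in> pverts G" using x in_arcsD2 by blast
  have "d u w \<le> d u x + d x w" using dist_triangle assms xV by blast
  moreover have "d u x \<le> d u v" using mmd x mutually_maximally_distant_iff assms by blast
  moreover have "d u w = d v w + d u v"
    using eq dist_commute assms by metis
  ultimately show False using x(2) by linarith
qed

text \<open>
  A longest shortest path through \<open>u\<close> and \<open>v\<close> has mutually maximally distant ends, since a
  neighbour further away would prolong it.
\<close>

lemma extend_to_mutually_maximally_distant:
  assumes uv: "u \<in> pverts G" "v \<in> pverts G"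
  obtains x y where "x \<in> pverts G" "y \<in> pverts G" "mutually_maximally_distant G x y"
    "d x y = d x u + d u v + d v y"
proof -
  define Q where "Q = {(x, y). x \<in> pverts G \<and> y \<in> pverts G \<and> d x y = d x u + d u v + d v y}"
  have "finite (pverts G \<times> pverts G)" by (simp add: pair_finite_verts)
  then have finQ: "finite Q" by (rule finite_subset[rotated]) (auto simp: Q_def)
  have "(u, v) \<in> Q" using uv by (simp add: Q_def dist_self)
  then have "Q \<noteq> {}" by blast
  from finite_has_maximal[OF finite_imageI[OF finQ, of "\<lambda>(x, y). d x y"]] this
  obtain x y where xy: "(x, y) \<in> Q" and max: "\<And>x' y'. (x', y') \<in> Q \<Longrightarrow> d x' y' \<le> d x y"
    by (smt (verit, best) image_iff image_is_empty linorder_not_le order_less_imp_le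
        order.strict_iff_order case_prod_conv surj_pair)
  have xyV: "x \<in> pverts G" "y \<in> pverts G" and eq: "d x y = d x u + d u v + d v y"
    using xy by (auto simp: Q_def)
  have "d x' y \<le> d x y" if "(x, x') \<in> parcs G" for x'
  proof (rule ccontr)
    assume far: "\<not> d x' y \<le> d x y"
    have x'V: "x' \<in> pverts G" using that in_arcsD2 by blast
    have "d x' u \<le> Suc (d x u)" using dist_step[OF arc_sym[OF that] uv(1)] .
    moreover have "d x' y \<le> d x' u + d u y" "d u y \<le> d u v + d v y"
      using dist_triangle uv xyV x'V by blast+
    ultimately have "(x', y) \<in> Q" using far eq x'V xyV by (auto simp: Q_def)
    from max[OF this] far show False by simp
  qed
  moreover have "d x y' \<le> d x y" if "(y, y') \<in> parcs G" for y'
  proof (rule ccontr)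
    assume far: "\<not> d x y' \<le> d x y"
    have y'V: "y' \<in> pverts G" using that in_arcsD2 by blast
    have "d y' v \<le> Suc (d y v)" using dist_step[OF arc_sym[OF that] uv(2)] .
    then have "d v y' \<le> Suc (d v y)" using dist_commute uv xyV y'V by metis
    moreover have "d x y' \<le> d x v + d v y'" "d x v \<le> d x u + d u v"
      using dist_triangle uv xyV y'V by blast+
    ultimately have "(x, y') \<in> Q" using far eq y'V xyV by (auto simp: Q_def)
    from max[OF this] far show False by simp
  qed
  ultimately have "mutually_maximally_distant G x y"
    using mutually_maximally_distant_iff xyV by blast
  then show thesis using that xyV eq by blast
qed

lemma strong_metric_generator_iff_vertex_cover:
  "strong_metric_generator G S \<longleftrightarrow> vertex_cover (strong_resolving_graph G) S"
proof
  assume S: "strong_metric_generator G S"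
  have "u \<in> S \<or> v \<in> S" if "(u, v) \<in> parcs (strong_resolving_graph G)" for u v
  proof -
    have uv: "u \<in> pverts G" "v \<in> pverts G" "u \<noteq> v" "mutually_maximally_distant G u v"
      using that by (auto simp: strong_resolving_graph_def)
    then have vu: "mutually_maximally_distant G v u"
      by (auto simp: mutually_maximally_distant_def)
    obtain w where w: "w \<in> S" "strongly_resolves G w u v"
      using S uv unfolding strong_metric_generator_def by blast
    have wV: "w \<in> pverts G" using S w by (auto simp: strong_metric_generator_def)
    consider "d w u = d w v + d v u" | "d w v = d w u + d u v"
      using w(2) strongly_resolves_iff uv wV by blast
    then have "w = v \<or> w = u"
      using resolver_beyond_maximally_distant uv vu wV by metis
    then show ?thesis using w by blast
  qed
  then show "vertex_cover (strong_resolving_graph G) S"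
    using S by (auto simp: vertex_cover_def strong_metric_generator_def strong_resolving_graph_def)
next
  assume S: "vertex_cover (strong_resolving_graph G) S"
  have SV: "S \<subseteq> pverts G" using S by (simp add: vertex_cover_def strong_resolving_graph_def)
  have "\<exists>w\<in>S. strongly_resolves G w u v" if uv: "u \<in> pverts G" "v \<in> pverts G" "u \<noteq> v" for u v
  proof -
    obtain x y where xy: "x \<in> pverts G" "y \<in> pverts G" "mutually_maximally_distant G x y"
        and eq: "d x y = d x u + d u v + d v y"
      using extend_to_mutually_maximally_distant uv by blast
    have "d u v \<noteq> 0" using uv dist_eq_0_iff by simp
    then have "x \<noteq> y" using eq dist_self xy by fastforce
    then have "(x, y) \<in> parcs (strong_resolving_graph G)"
      using xy by (simp add: strong_resolving_graph_def)
    then consider "x \<in> S" | "y \<in> S" using S by (auto simp: vertex_cover_def)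
    then show ?thesis
    proof cases
      case 1
      have "d x y \<le> d x v + d v y" "d x v \<le> d x u + d u v" using dist_triangle xy uv by blast+
      then have "d x v = d x u + d u v" using eq by linarith
      then show ?thesis using 1 strongly_resolves_iff uv xy by blast
    next
      case 2
      have "d x y \<le> d x u + d u y" "d u y \<le> d u v + d v y" using dist_triangle xy uv by blast+
      then have "d u y = d u v + d v y" using eq by linarith
      then have "d y u = d y v + d v u" using dist_commute xy uv by simp
      then show ?thesis using 2 strongly_resolves_iff uv xy by blast
    qed
  qed
  then show "strong_metric_generator G S" using SV by (simp add: strong_metric_generator_def)
qed

lemma strong_metric_dim_eq_vertex_cover_number:
  "strong_metric_dim G = vertex_cover_number (strong_resolving_graph G)"
  by (simp add: strong_metric_dim_def vertex_cover_number_def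
      strong_metric_generator_iff_vertex_cover)

end

section \<open>Graphs in which non-adjacent vertices have a common neighbour\<close>

text \<open>
  Besides being the distance in such graphs, this is the distance inside one copy of \<open>H\<close> in a
  product \<open>G \<circ> H\<close>, whatever \<open>H\<close> is.
\<close>

definition capped_dist :: "'a pair_pre_digraph \<Rightarrow> 'a \<Rightarrow> 'a \<Rightarrow> nat" where
  "capped_dist H u v = (if u = v then 0 else if (u, v) \<in> parcs H then 1 else 2)"

text \<open>The graph called \<open>T(H)\<close> above.\<close>

definition nonadjacent_or_twins_graph :: "'a pair_pre_digraph \<Rightarrow> 'a pair_pre_digraph" where
  "nonadjacent_or_twins_graph H =
    \<lparr> pverts = pverts H,
      parcs = {(u, v). u \<in> pverts H \<and> v \<in> pverts H \<and> u \<noteq> v \<and>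
        ((u, v) \<notin> parcs H \<or> closed_nbhd H u = closed_nbhd H v)} \<rparr>"

context pair_graph
begin

lemma mem_closed_nbhd_iff: "x \<in> closed_nbhd G u \<longleftrightarrow> (u, x) \<in> parcs G \<or> x = u"
  by (auto simp: closed_nbhd_def nbhd_def)

lemma finite_arc_graph_nonadjacent_or_twins_graph:
  "finite_arc_graph (nonadjacent_or_twins_graph G)"
  using pair_finite_verts by (auto simp: finite_arc_graph_def nonadjacent_or_twins_graph_def)

text \<open>
  At value \<open>2\<close> nothing is further away; at value \<open>1\<close> nothing is further away exactly when each
  neighbour of one vertex is in the closed neighbourhood of the other.
\<close>

lemma capped_maximal_iff:
  assumes "u \<noteq> v"
  shows "(\<forall>x. (u, x) \<in> parcs G \<longrightarrow> capped_dist G x v \<le> capped_dist G u v) \<and>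
      (\<forall>x. (v, x) \<in> parcs G \<longrightarrow> capped_dist G u x \<le> capped_dist G u v) \<longleftrightarrow>
    (u, v) \<notin> parcs G \<or> closed_nbhd G u = closed_nbhd G v"
proof (cases "(u, v) \<in> parcs G")
  case False
  then show ?thesis using assms by (auto simp: capped_dist_def)
next
  case True
  then have "(v, u) \<in> parcs G" by (rule arc_sym)
  have "(\<forall>x. (u, x) \<in> parcs G \<longrightarrow> capped_dist G x v \<le> capped_dist G u v) \<longleftrightarrow>
      closed_nbhd G u \<subseteq> closed_nbhd G v"
    using assms True \<open>(v, u) \<in> parcs G\<close> arc_sym
    by (auto simp: capped_dist_def subset_iff mem_closed_nbhd_iff)
  moreover have "(\<forall>x. (v, x) \<in> parcs G \<longrightarrow> capped_dist G u x \<le> capped_dist G u v) \<longleftrightarrow>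
      closed_nbhd G v \<subseteq> closed_nbhd G u"
    using assms True \<open>(v, u) \<in> parcs G\<close> arc_sym
    by (auto simp: capped_dist_def subset_iff mem_closed_nbhd_iff)
  ultimately show ?thesis using True by blast
qed

lemma graph_distance_capped_dist:
  assumes common: "\<And>u v. \<lbrakk>u \<in> pverts G; v \<in> pverts G; u \<noteq> v; (u, v) \<notin> parcs G\<rbrakk> \<Longrightarrow>
      \<exists>x. (u, x) \<in> parcs G \<and> (x, v) \<in> parcs G"
  shows "graph_distance G (capped_dist G)"
proof unfold_locales
  fix u v assume uv: "u \<in> pverts G" "v \<in> pverts G" "u \<noteq> v"
  show "\<exists>x. (u, x) \<in> parcs G \<and> capped_dist G u v = Suc (capped_dist G x v)"
  proof (cases "(u, v) \<in> parcs G")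
    case True
    then show ?thesis using uv by (intro exI[of _ v]) (simp add: capped_dist_def)
  next
    case False
    then obtain x where "(u, x) \<in> parcs G" "(x, v) \<in> parcs G" using common uv by blast
    then show ?thesis using uv False by (intro exI[of _ x]) (auto simp: capped_dist_def)
  qed
qed (auto simp: capped_dist_def)

lemma strong_metric_dim_if_common_neighbours:
  assumes common: "\<And>u v. \<lbrakk>u \<in> pverts G; v \<in> pverts G; u \<noteq> v; (u, v) \<notin> parcs G\<rbrakk> \<Longrightarrow>
      \<exists>x. (u, x) \<in> parcs G \<and> (x, v) \<in> parcs G"
  shows "strong_metric_dim G = vertex_cover_number (nonadjacent_or_twins_graph G)"
proof -
  interpret D: graph_distance G "capped_dist G"
    using graph_distance_capped_dist[OF common] .
  have "strong_resolving_graph G = nonadjacent_or_twins_graph G"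
    unfolding strong_resolving_graph_def nonadjacent_or_twins_graph_def
    by (auto simp: D.mutually_maximally_distant_iff capped_maximal_iff)
  then show ?thesis using D.strong_metric_dim_eq_vertex_cover_number by simp
qed

lemma common_neighbour_if_gdist_le_2:
  assumes "gdist G u v \<le> 2" "u \<noteq> v" "(u, v) \<notin> parcs G"
  shows "\<exists>x. (u, x) \<in> parcs G \<and> (x, v) \<in> parcs G"
proof -
  \<comment> \<open>A bound strictly above \<open>2\<close> is needed to extract a walk from the infimum.\<close>
  have "\<mu> (\<lambda>_. 1) u v < ereal 3"
    using assms(1) by (simp add: gdist_def) (erule order_le_less_trans, simp)
  then obtain p where p: "awalk u p v" "length p < 3"
    unfolding \<mu>_def by (auto simp: INF_less_iff walk_cost_eq_length)
  then consider "p = []" | e where "p = [e]" | e e' where "p = [e, e']"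
    by (cases p; cases "tl p"; cases "tl (tl p)") auto
  then show ?thesis
    using p(1) assms(2,3) by cases (auto simp: awalk_Nil_iff awalk_Cons_iff)
qed

lemma strong_metric_dim_if_diameter_2:
  assumes "diameter G = 2"
  shows "strong_metric_dim G = vertex_cover_number (nonadjacent_or_twins_graph G)"
proof (rule strong_metric_dim_if_common_neighbours)
  fix u v assume "u \<in> pverts G" "v \<in> pverts G" "u \<noteq> v" "(u, v) \<notin> parcs G"
  moreover from this have "gdist G u v \<le> diameter G"
    unfolding diameter_def by (intro SUP_upper2[of "(u, v)"]) auto
  ultimately show "\<exists>x. (u, x) \<in> parcs G \<and> (x, v) \<in> parcs G"
    using assms common_neighbour_if_gdist_le_2 by simp
qed

lemma no_dominating_vertex:
  assumes "max_degree G \<le> card (pverts G) - 2" "card (pverts G) \<ge> 2" "v \<in> pverts G"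
  obtains x where "x \<in> pverts G" "x \<noteq> v" "(v, x) \<notin> parcs G"
proof -
  have "out_arcs (with_proj G) v = Pair v ` nbhd G v"
    by (auto simp: out_arcs_def nbhd_def)
  then have "out_degree (with_proj G) v = card (nbhd G v)"
    by (simp add: out_degree_def card_image inj_on_def)
  then have "card (nbhd G v) \<le> max_degree G"
    using assms(3) pair_finite_verts by (auto simp: max_degree_def intro!: Max_ge image_eqI)
  moreover have "card (closed_nbhd G v) \<le> card (nbhd G v) + 1"
    unfolding closed_nbhd_def by (rule order_trans[OF card_Un_le]) simp
  ultimately have "card (closed_nbhd G v) < card (pverts G)" using assms by linarith
  moreover have "finite (closed_nbhd G v)"
    by (rule finite_subset[OF _ pair_finite_verts])
      (use assms(3) in_arcsD2 in \<open>auto simp: mem_closed_nbhd_iff\<close>)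
  ultimately have "\<not> pverts G \<subseteq> closed_nbhd G v"
    using card_mono by (metis linorder_not_le)
  then obtain x where "x \<in> pverts G" "x \<notin> closed_nbhd G v" by blast
  then show thesis using that by (simp add: mem_closed_nbhd_iff)
qed

text \<open>
  The apex is a common neighbour of all other vertices. It is adjacent to each of them, and a
  vertex that is its true twin would dominate \<open>G\<close>; so it is isolated in the strong resolving graph.
\<close>

lemma strong_metric_dim_K1_join:
  assumes no_dom: "\<And>v. v \<in> pverts G \<Longrightarrow> \<exists>x\<in>pverts G. x \<noteq> v \<and> (v, x) \<notin> parcs G"
  shows "strong_metric_dim (K1_join G) = vertex_cover_number (nonadjacent_or_twins_graph G)"
proof -
  interpret K: pair_graph "K1_join G" by (rule pair_graph_K1_join) unfold_locales
  have arcs [simp]: "(Some u, Some v) \<in> parcs (K1_join G) \<longleftrightarrow> (u, v) \<in> parcs G"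
      "(None, Some v) \<in> parcs (K1_join G) \<longleftrightarrow> v \<in> pverts G"
      "(Some v, None) \<in> parcs (K1_join G) \<longleftrightarrow> v \<in> pverts G"
      "(None, None) \<notin> parcs (K1_join G)" for u v
    by (auto simp: K1_join_def)
  have verts: "pverts (K1_join G) = insert None (Some ` pverts G)" by (simp add: K1_join_def)
  have "strong_metric_dim (K1_join G) = vertex_cover_number (nonadjacent_or_twins_graph (K1_join G))"
  proof (rule K.strong_metric_dim_if_common_neighbours)
    fix u v assume "u \<in> pverts (K1_join G)" "v \<in> pverts (K1_join G)" "u \<noteq> v"
      "(u, v) \<notin> parcs (K1_join G)"
    then show "\<exists>x. (u, x) \<in> parcs (K1_join G) \<and> (x, v) \<in> parcs (K1_join G)"
      by (intro exI[of _ None]) (auto simp: verts)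
  qed
  also have "\<dots> = vertex_cover_number (nonadjacent_or_twins_graph G)"
  proof (rule vertex_cover_number_embedding)
    have nbhd_Some: "closed_nbhd (K1_join G) (Some u) = insert None (Some ` closed_nbhd G u)"
      if "u \<in> pverts G" for u
    proof (rule set_eqI)
      fix x show "x \<in> closed_nbhd (K1_join G) (Some u) \<longleftrightarrow> x \<in> insert None (Some ` closed_nbhd G u)"
        using that by (cases x) (auto simp: K.mem_closed_nbhd_iff mem_closed_nbhd_iff)
    qed
    have twins: "closed_nbhd (K1_join G) (Some u) = closed_nbhd (K1_join G) (Some v) \<longleftrightarrow>
        closed_nbhd G u = closed_nbhd G v" if "u \<in> pverts G" "v \<in> pverts G" for u v
    proof -
      have "insert None (Some ` X) = insert None (Some ` Y) \<longleftrightarrow> X = Y" for X Y :: "'a set"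
        by auto
      then show ?thesis using that by (simp only: nbhd_Some)
    qed
    have apex: "closed_nbhd (K1_join G) None \<noteq> closed_nbhd (K1_join G) (Some u)"
      if u: "u \<in> pverts G" for u
    proof -
      obtain x where "x \<in> pverts G" "x \<noteq> u" "(u, x) \<notin> parcs G" using no_dom[OF u] by blast
      then have "Some x \<in> closed_nbhd (K1_join G) None" "Some x \<notin> closed_nbhd (K1_join G) (Some u)"
        by (auto simp: K.mem_closed_nbhd_iff)
      then show ?thesis by blast
    qed
    show "parcs (nonadjacent_or_twins_graph (K1_join G)) =
        map_prod Some Some ` parcs (nonadjacent_or_twins_graph G)" (is "?L = ?R")
    proof (rule set_eqI)
      have Some_iff: "(Some u, Some v) \<in> ?L \<longleftrightarrow> (u, v) \<in> parcs (nonadjacent_or_twins_graph G)" for u v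
        by (cases "u \<in> pverts G \<and> v \<in> pverts G")
          (simp add: nonadjacent_or_twins_graph_def verts twins,
            auto simp: nonadjacent_or_twins_graph_def verts)
      have None_iff: "(None, x) \<notin> ?L" "(x, None) \<notin> ?L" for x
        using apex by (auto simp: nonadjacent_or_twins_graph_def verts)
      fix e :: "'a option \<times> 'a option"
      obtain a b where "e = (a, b)" by (cases e)
      then show "e \<in> ?L \<longleftrightarrow> e \<in> ?R"
        using Some_iff None_iff by (cases a; cases b) auto
    qed
  qed (fact K.finite_arc_graph_nonadjacent_or_twins_graph
      finite_arc_graph_nonadjacent_or_twins_graph |
      auto simp: nonadjacent_or_twins_graph_def verts)+
  finally show ?thesis .
qed

end

section \<open>The strong resolving graph of a lexicographic product\<close>

context graph_distance
begin

text \<open>For adjacent vertices every neighbour of one is within distance \<open>1\<close> of the other.\<close>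

lemma adjacent_mutually_maximally_distant_twins:
  assumes ac: "(a, c) \<in> parcs G" and mmd: "mutually_maximally_distant G a c"
  shows "closed_nbhd G a = closed_nbhd G c"
proof -
  have V: "a \<in> pverts G" "c \<in> pverts G" using ac in_arcsD1 in_arcsD2 by blast+
  have 1: "d a c = 1" using ac dist_eq_1_iff V by blast
  have near: "u = v \<or> (u, v) \<in> parcs G" if "d u v \<le> 1" "u \<in> pverts G" "v \<in> pverts G" for u v
    using that dist_eq_0_iff[of u v] dist_eq_1_iff[of u v] by (auto simp: le_Suc_eq)
  have "x = c \<or> (x, c) \<in> parcs G" if "(a, x) \<in> parcs G" for x
    using mmd that V 1 near[of x c] in_arcsD2[OF that] mutually_maximally_distant_iff by auto
  moreover have "a = x \<or> (a, x) \<in> parcs G" if "(c, x) \<in> parcs G" for x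
    using mmd that V 1 near[of a x] in_arcsD2[OF that] mutually_maximally_distant_iff by auto
  ultimately show ?thesis using ac arc_sym by (auto simp: mem_closed_nbhd_iff set_eq_iff)
qed

text \<open>
  Distinct closed neighbourhoods come for free for non-adjacent vertices, so in the definition of
  \<open>G\<^sub>S\<^sub>R\<^sub>S\<close> this condition removes exactly the adjacent pairs.
\<close>

lemma TF_arc_iff:
  assumes V: "a \<in> pverts G" "c \<in> pverts G"
  shows "(a, c) \<in> parcs (strong_resolving_TF_graph G) \<longleftrightarrow>
    a \<noteq> c \<and> (a, c) \<notin> parcs G \<and> mutually_maximally_distant G a c"
proof -
  have "(a, c) \<in> parcs (strong_resolving_TF_graph G) \<longleftrightarrow>
      mutually_maximally_distant G a c \<and> closed_nbhd G a \<noteq> closed_nbhd G c"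
    using V by (auto simp: strong_resolving_TF_graph_def TF_boundary_def
        mutually_maximally_distant_def)
  moreover have "closed_nbhd G a \<noteq> closed_nbhd G c" if "a \<noteq> c" "(a, c) \<notin> parcs G"
    using that mem_closed_nbhd_iff arc_sym by blast
  ultimately show ?thesis using adjacent_mutually_maximally_distant_twins by blast
qed

end

text \<open>
  With two vertices in the connected graph \<open>G\<close>, every copy of \<open>H\<close> has a neighbouring copy, which
  bounds the distances inside it by \<open>2\<close>. The second condition is the bound on \<open>\<Delta>(H)\<close>.
\<close>

locale lex_product_graphs =
  graph_distance G d + H: pair_graph H
  for G :: "'a pair_pre_digraph" and d and H :: "'b pair_pre_digraph" +
  assumes two_vertices: "card (pverts G) \<ge> 2"
    and no_dominating: "\<And>b. b \<in> pverts H \<Longrightarrow> \<exists>b'\<in>pverts H. b' \<noteq> b \<and> (b, b') \<notin> parcs H"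
begin

definition product_dist :: "'a \<times> 'b \<Rightarrow> 'a \<times> 'b \<Rightarrow> nat" where
  "product_dist p q = (if fst p = fst q then capped_dist H (snd p) (snd q) else d (fst p) (fst q))"

lemma product_verts [simp]: "pverts (lex_product G H) = pverts G \<times> pverts H"
  by (simp add: lex_product_def)

lemma product_arc_iff:
  assumes "(a, b) \<in> pverts (lex_product G H)" "(c, e) \<in> pverts (lex_product G H)"
  shows "((a, b), (c, e)) \<in> parcs (lex_product G H) \<longleftrightarrow> (a, c) \<in> parcs G \<or> a = c \<and> (b, e) \<in> parcs H"
  using assms by (auto simp: lex_product_def)

lemma obtain_neighbour:
  assumes "a \<in> pverts G"
  obtains c where "(a, c) \<in> parcs G"
proof -
  have "pverts G \<noteq> {a}" using two_vertices by auto
  then obtain v where "v \<in> pverts G" "v \<noteq> a" using assms by blast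
  then show thesis using dist_descent[OF assms] that by metis
qed

lemma graph_distance_product_dist: "graph_distance (lex_product G H) product_dist"
proof -
  interpret P: pair_graph "lex_product G H"
    by (rule pair_graph_lex_product) unfold_locales
  show ?thesis
  proof unfold_locales
    fix p q assume "p \<in> pverts (lex_product G H)" "q \<in> pverts (lex_product G H)"
    then show "product_dist p q = 0 \<longleftrightarrow> p = q"
      by (cases p; cases q) (auto simp: product_dist_def capped_dist_def dist_eq_0_iff)
  next
    fix p x q assume px: "(p, x) \<in> parcs (lex_product G H)" and q: "q \<in> pverts (lex_product G H)"
    obtain a b a' b' c e where pxq: "p = (a, b)" "x = (a', b')" "q = (c, e)"
      by (metis surj_pair)
    have V: "a \<in> pverts G" "a' \<in> pverts G" "c \<in> pverts G" and
        arc: "(a, a') \<in> parcs G \<or> a = a' \<and> (b, b') \<in> parcs H"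
      using px q pxq by (auto simp: lex_product_def)
    show "product_dist p q \<le> Suc (product_dist x q)"
    proof (cases "(a, a') \<in> parcs G")
      case True
      then have "a \<noteq> a'" using arc_irrefl by blast
      moreover have "d a c \<le> Suc (d a' c)" using dist_step True V by blast
      moreover have "d a a' \<le> 1" using dist_arc_le True by blast
      moreover have "d a' a \<noteq> 0" using \<open>a \<noteq> a'\<close> dist_eq_0_iff V by simp
      ultimately show ?thesis
        by (auto simp: pxq product_dist_def capped_dist_def)
    next
      case False
      then show ?thesis using arc
        by (auto simp: pxq product_dist_def capped_dist_def)
    qed
  next
    fix p q
    assume pq: "p \<in> pverts (lex_product G H)" "q \<in> pverts (lex_product G H)" "p \<noteq> q"
    obtain a b c e where pq_eq: "p = (a, b)" "q = (c, e)" by (metis surj_pair)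
    have V: "a \<in> pverts G" "c \<in> pverts G" "b \<in> pverts H" "e \<in> pverts H"
      using pq pq_eq by auto
    show "\<exists>x. (p, x) \<in> parcs (lex_product G H) \<and> product_dist p q = Suc (product_dist x q)"
    proof (cases "a = c")
      case False
      then obtain x where x: "(a, x) \<in> parcs G" "d a c = Suc (d x c)"
        using dist_descent V by blast
      have xV: "x \<in> pverts G" using x in_arcsD2 by blast
      \<comment> \<open>The fibre coordinate \<open>e\<close> also serves the last step, when \<open>x = c\<close>.\<close>
      show ?thesis
        using False x V xV dist_self
        by (intro exI[of _ "(x, e)"]) (auto simp: pq_eq product_arc_iff product_dist_def capped_dist_def)
    next
      case True
      show ?thesis
      proof (cases "(b, e) \<in> parcs H")
        case True
        then show ?thesis
          using \<open>a = c\<close> V pq by (intro exI[of _ q])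
            (auto simp: pq_eq product_arc_iff product_dist_def capped_dist_def)
      next
        case False
        obtain x where x: "(a, x) \<in> parcs G" using obtain_neighbour V by blast
        then have xa: "(x, a) \<in> parcs G" "x \<noteq> a" "x \<in> pverts G"
          using arc_sym arc_irrefl in_arcsD2 by blast+
        then have "d x a = 1" using dist_eq_1_iff V by blast
        then show ?thesis
          using \<open>a = c\<close> False V pq x xa by (intro exI[of _ "(x, b)"])
            (auto simp: pq_eq product_arc_iff product_dist_def capped_dist_def)
      qed
    qed
  qed
qed

sublocale P: graph_distance "lex_product G H" product_dist
  by (rule graph_distance_product_dist)

lemma same_copy_mutually_maximally_distant_iff:
  assumes V: "a \<in> pverts G" "b \<in> pverts H" "e \<in> pverts H" and "b \<noteq> e"
  shows "mutually_maximally_distant (lex_product G H) (a, b) (a, e) \<longleftrightarrow>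
    (b, e) \<notin> parcs H \<or> closed_nbhd H b = closed_nbhd H e"
proof -
  \<comment> \<open>A neighbour outside the copy is at distance \<open>1\<close> and therefore never a counterexample.\<close>
  have near: "product_dist (x, y) (a, e) \<le> capped_dist H b e"
      "product_dist (a, b) (x, y) \<le> capped_dist H b e"
    if "(a, x) \<in> parcs G" for x y
  proof -
    have "x \<in> pverts G" "x \<noteq> a" "(x, a) \<in> parcs G"
      using that in_arcsD2 arc_irrefl arc_sym by blast+
    then have "product_dist (x, y) (a, e) = 1" "product_dist (a, b) (x, y) = 1"
      using that dist_eq_1_iff V by (auto simp: product_dist_def)
    moreover have "1 \<le> capped_dist H b e" using \<open>b \<noteq> e\<close> by (simp add: capped_dist_def)
    ultimately show "product_dist (x, y) (a, e) \<le> capped_dist H b e"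
        "product_dist (a, b) (x, y) \<le> capped_dist H b e"
      by simp_all
  qed
  have inside: "product_dist (a, y) (a, y') = capped_dist H y y'" for y y'
    by (simp add: product_dist_def)
  have "mutually_maximally_distant (lex_product G H) (a, b) (a, e) \<longleftrightarrow>
      (\<forall>x y. ((a, b), (x, y)) \<in> parcs (lex_product G H) \<longrightarrow>
        product_dist (x, y) (a, e) \<le> capped_dist H b e) \<and>
      (\<forall>x y. ((a, e), (x, y)) \<in> parcs (lex_product G H) \<longrightarrow>
        product_dist (a, b) (x, y) \<le> capped_dist H b e)"
    using V by (simp add: P.mutually_maximally_distant_iff) (simp add: product_dist_def)
  also have "\<dots> \<longleftrightarrow> (\<forall>y. (b, y) \<in> parcs H \<longrightarrow> capped_dist H y e \<le> capped_dist H b e) \<and>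
      (\<forall>y. (e, y) \<in> parcs H \<longrightarrow> capped_dist H b y \<le> capped_dist H b e)"
  proof (rule arg_cong2[where f = "(\<and>)"], goal_cases)
    case 1
    have arc: "((a, b), (x, y)) \<in> parcs (lex_product G H) \<longleftrightarrow>
        x \<in> pverts G \<and> y \<in> pverts H \<and> ((a, x) \<in> parcs G \<or> a = x \<and> (b, y) \<in> parcs H)" for x y
      using V by (auto simp: lex_product_def)
    show ?case
      unfolding arc using near inside V(1) H.in_arcsD2 by metis
  next
    case 2
    have arc: "((a, e), (x, y)) \<in> parcs (lex_product G H) \<longleftrightarrow>
        x \<in> pverts G \<and> y \<in> pverts H \<and> ((a, x) \<in> parcs G \<or> a = x \<and> (e, y) \<in> parcs H)" for x y
      using V by (auto simp: lex_product_def)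
    show ?case
      unfolding arc using near inside V(1) H.in_arcsD2 by metis
  qed
  also have "\<dots> \<longleftrightarrow> (b, e) \<notin> parcs H \<or> closed_nbhd H b = closed_nbhd H e"
    using \<open>b \<noteq> e\<close> by (rule H.capped_maximal_iff)
  finally show ?thesis .
qed

lemma different_copies_mutually_maximally_distant_iff:
  assumes V: "a \<in> pverts G" "c \<in> pverts G" "b \<in> pverts H" "e \<in> pverts H" and "a \<noteq> c"
  shows "mutually_maximally_distant (lex_product G H) (a, b) (c, e) \<longleftrightarrow>
    (a, c) \<notin> parcs G \<and> mutually_maximally_distant G a c"
proof (cases "(a, c) \<in> parcs G")
  case True
  then have 1: "d a c = 1" using dist_eq_1_iff V by blast
  \<comment> \<open>The vertex of the copy of \<open>c\<close> that is further from \<open>(c, e)\<close> than \<open>(a, b)\<close> is.\<close>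
  obtain y where y: "y \<in> pverts H" "y \<noteq> e" "(e, y) \<notin> parcs H" using no_dominating V by blast
  then have "(y, e) \<notin> parcs H" using H.arc_sym by blast
  then have "product_dist (c, y) (c, e) = 2" using y by (simp add: product_dist_def capped_dist_def)
  moreover have "product_dist (a, b) (c, e) = 1" using 1 \<open>a \<noteq> c\<close> by (simp add: product_dist_def)
  moreover have "((a, b), (c, y)) \<in> parcs (lex_product G H)"
    using True V y by (simp add: product_arc_iff)
  ultimately have "\<not> mutually_maximally_distant (lex_product G H) (a, b) (c, e)"
    using V P.mutually_maximally_distant_iff[of "(a, b)" "(c, e)"] by fastforce
  then show ?thesis using True by blast
next
  case False
  then have "(c, a) \<notin> parcs G" using arc_sym by blast
  have "mutually_maximally_distant (lex_product G H) (a, b) (c, e) \<longleftrightarrow>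
      (\<forall>x y. ((a, b), (x, y)) \<in> parcs (lex_product G H) \<longrightarrow>
        product_dist (x, y) (c, e) \<le> d a c) \<and>
      (\<forall>x y. ((c, e), (x, y)) \<in> parcs (lex_product G H) \<longrightarrow>
        product_dist (a, b) (x, y) \<le> d a c)"
    using V \<open>a \<noteq> c\<close> by (simp add: P.mutually_maximally_distant_iff) (simp add: product_dist_def)
  also have "\<dots> \<longleftrightarrow> (\<forall>x. (a, x) \<in> parcs G \<longrightarrow> d x c \<le> d a c) \<and>
      (\<forall>x. (c, x) \<in> parcs G \<longrightarrow> d a x \<le> d a c)"
  proof (rule arg_cong2[where f = "(\<and>)"], goal_cases)
    case 1
    have arc: "((a, b), (x, y)) \<in> parcs (lex_product G H) \<longleftrightarrow>
        x \<in> pverts G \<and> y \<in> pverts H \<and> ((a, x) \<in> parcs G \<or> a = x \<and> (b, y) \<in> parcs H)" for x y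
      using V by (auto simp: lex_product_def)
    have "product_dist (x, y) (c, e) = d x c" if "(a, x) \<in> parcs G \<or> a = x" for x y
      using that False \<open>a \<noteq> c\<close> by (auto simp: product_dist_def)
    then show ?case unfolding arc using V in_arcsD2 by (metis order_refl)
  next
    case 2
    have arc: "((c, e), (x, y)) \<in> parcs (lex_product G H) \<longleftrightarrow>
        x \<in> pverts G \<and> y \<in> pverts H \<and> ((c, x) \<in> parcs G \<or> c = x \<and> (e, y) \<in> parcs H)" for x y
      using V by (auto simp: lex_product_def)
    have "product_dist (a, b) (x, y) = d a x" if "(c, x) \<in> parcs G \<or> c = x" for x y
      using that \<open>(c, a) \<notin> parcs G\<close> \<open>a \<noteq> c\<close> by (auto simp: product_dist_def)
    then show ?case unfolding arc using V in_arcsD2 by (metis order_refl)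
  qed
  also have "\<dots> \<longleftrightarrow> mutually_maximally_distant G a c"
    using mutually_maximally_distant_iff V by simp
  finally show ?thesis using False by simp
qed

lemma strong_resolving_graph_lex_product:
  "strong_resolving_graph (lex_product G H) =
    lex_product \<lparr> pverts = pverts G, parcs = parcs (strong_resolving_TF_graph G) \<rparr>
      (nonadjacent_or_twins_graph H)" (is "?L = ?R")
proof -
  have "(p, q) \<in> parcs ?L \<longleftrightarrow> (p, q) \<in> parcs ?R" for p q
  proof (cases "p \<in> pverts G \<times> pverts H \<and> q \<in> pverts G \<times> pverts H")
    case False
    then show ?thesis
      by (auto simp: strong_resolving_graph_def lex_product_def nonadjacent_or_twins_graph_def)
  next
    case True
    obtain a b c e where pq: "p = (a, b)" "q = (c, e)" by (metis surj_pair)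
    have V: "a \<in> pverts G" "c \<in> pverts G" "b \<in> pverts H" "e \<in> pverts H"
      using True pq by auto
    have L: "(p, q) \<in> parcs ?L \<longleftrightarrow>
        p \<noteq> q \<and> mutually_maximally_distant (lex_product G H) (a, b) (c, e)"
      using V by (simp add: strong_resolving_graph_def pq)
    have R: "(p, q) \<in> parcs ?R \<longleftrightarrow> (a, c) \<in> parcs (strong_resolving_TF_graph G) \<or>
        a = c \<and> b \<noteq> e \<and> ((b, e) \<notin> parcs H \<or> closed_nbhd H b = closed_nbhd H e)"
      using V by (auto simp: lex_product_def nonadjacent_or_twins_graph_def pq)
    show ?thesis
    proof (cases "a = c")
      case True
      then show ?thesis
        using V same_copy_mutually_maximally_distant_iff[of a b e] TF_arc_iff[of a c]
        unfolding L R by (auto simp: pq)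
    next
      case False
      then show ?thesis
        using different_copies_mutually_maximally_distant_iff[OF V False] TF_arc_iff[of a c] V
        unfolding L R by (auto simp: pq)
    qed
  qed
  then have "parcs ?L = parcs ?R" by auto
  moreover have "pverts ?L = pverts ?R"
    by (simp add: strong_resolving_graph_def lex_product_def nonadjacent_or_twins_graph_def)
  ultimately show ?thesis by simp
qed

lemma strong_metric_dim_lex_product:
  defines "\<alpha> \<equiv> vertex_cover_number (strong_resolving_TF_graph G)"
    and "\<beta> \<equiv> vertex_cover_number (nonadjacent_or_twins_graph H)"
  shows "strong_metric_dim (lex_product G H) + \<alpha> * \<beta> = card (pverts G) * \<beta> + card (pverts H) * \<alpha>"
proof -
  let ?A = "\<lparr> pverts = pverts G, parcs = parcs (strong_resolving_TF_graph G) \<rparr>"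
  have TF: "finite_arc_graph (strong_resolving_TF_graph G)"
    by (intro finite_arc_graph_if_pair_graph pair_graph_strong_resolving_TF_graph) unfold_locales
  have sub: "pverts (strong_resolving_TF_graph G) \<subseteq> pverts G"
    by (auto simp: strong_resolving_TF_graph_def TF_boundary_def)
  have A: "finite_arc_graph ?A"
    using TF sub pair_finite_verts by (auto simp: finite_arc_graph_def)
  have "vertex_cover_number ?A = \<alpha>"
    unfolding \<alpha>_def
    by (rule vertex_cover_number_embedding[where f = id]) (use A TF sub in \<open>auto simp: map_prod.id\<close>)
  moreover have "pverts (nonadjacent_or_twins_graph H) = pverts H"
    by (simp add: nonadjacent_or_twins_graph_def)
  ultimately show ?thesis
    using vertex_cover_number_lex_product[OF A H.finite_arc_graph_nonadjacent_or_twins_graph]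
    by (simp add: P.strong_metric_dim_eq_vertex_cover_number strong_resolving_graph_lex_product
        \<beta>_def)
qed

end

section \<open>The strong metric dimension of a lexicographic product\<close>

theorem theorem17:
  fixes G :: "'a pair_pre_digraph" and H :: "'b pair_pre_digraph" and n n' :: nat
  assumes "pair_graph G" and "connected (with_proj G)" and "\<not> is_complete G"
    and "card (pverts G) = n" and "n \<ge> 2"
    and "pair_graph H" and "card (pverts H) = n'" and "n' \<ge> 2"
    and "max_degree H \<le> n' - 2"
  shows "(diameter H = 2 \<longrightarrow>
      int (strong_metric_dim (lex_product G H)) =
        int n * int (strong_metric_dim H)
        + int n' * int (vertex_cover_number (strong_resolving_TF_graph G))
        - int (vertex_cover_number (strong_resolving_TF_graph G)) * int (strong_metric_dim H)) \<and>
    (diameter H > 2 \<longrightarrow>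
      int (strong_metric_dim (lex_product G H)) =
        int n * int (strong_metric_dim (K1_join H))
        + int n' * int (vertex_cover_number (strong_resolving_TF_graph G))
        - int (vertex_cover_number (strong_resolving_TF_graph G)) * int (strong_metric_dim (K1_join H)))"
proof -
  interpret G: pair_graph G by fact
  interpret H: pair_graph H by fact
  obtain d where "graph_distance G d" using G.connected_graph_distance assms(2) by blast
  then interpret D: graph_distance G d .
  have no_dom: "\<exists>x\<in>pverts H. x \<noteq> v \<and> (v, x) \<notin> parcs H" if "v \<in> pverts H" for v
    using H.no_dominating_vertex[of v] that assms(7-9) by metis
  interpret L: lex_product_graphs G d H
    using no_dom assms(4,5) by unfold_locales auto
  define \<alpha> \<beta> where "\<alpha> = vertex_cover_number (strong_resolving_TF_graph G)"
    and "\<beta> = vertex_cover_number (nonadjacent_or_twins_graph H)"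
  have "strong_metric_dim (lex_product G H) + \<alpha> * \<beta> = n * \<beta> + n' * \<alpha>"
    using L.strong_metric_dim_lex_product assms(4,7) by (simp add: \<alpha>_def \<beta>_def)
  then have "int (strong_metric_dim (lex_product G H)) + int \<alpha> * int \<beta> =
      int n * int \<beta> + int n' * int \<alpha>"
    by (metis of_nat_add of_nat_mult)
  then have formula: "int (strong_metric_dim (lex_product G H)) =
      int n * int \<beta> + int n' * int \<alpha> - int \<alpha> * int \<beta>"
    by linarith
  have "strong_metric_dim (K1_join H) = \<beta>"
    unfolding \<beta>_def using no_dom by (rule H.strong_metric_dim_K1_join)
  moreover have "strong_metric_dim H = \<beta>" if "diameter H = 2"
    unfolding \<beta>_def using that by (rule H.strong_metric_dim_if_diameter_2)
  ultimately show ?thesis using formula by (simp add: \<alpha>_def)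
qed

end
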